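(* Let $m,n\ge 1$ and let $S=\{p_1,\dots,p_m\}$ be a set of $m$ probability distributions, each with $n$ states. Let $\mathcal{G}_S$ be the sequence of state weights produced by the greedy coupling algorithm on $S$, and let $\bigwedge S$ be the greatest lower bound of $S$ with respect to majorization. Then $$H(\mathcal{G}_S)\le H\left(\bigwedge S\right)+\log_2(e).$$
   Context: $H$ denotes Shannon entropy with logarithms in base $2$, i.e. $H(p)=\sum_i p(i)\log_2(1/p(i))$ with $0\log_2(1/0)=0$. The states of every distribution $p$ are indexed in non-increasing order, $p(1)\ge p(2)\ge\cdots$. Majorization: $p\preceq q$ ($p$ is majorized by $q$) if $\sum_{j=1}^i p(j)\le\sum_{j=1}^i q(j)$ for all $i$ (padding with zeros if needed). $\bigwedge S$ is the greatest lower bound of $S$ for $\preceq$: $\bigwedge S\preceq p$ for all $p\in S$, and $r\preceq\bigwedge S$ whenever $r\preceq p$ for all $p\in S$. Explicitly, $\bigwedge S$ is the distribution $\mathcal{M}_S$ on $n$ states with $\sum_{j=1}^i\mathcal{M}_S(j)=\min_{p\in S}\sum_{j=1}^i p(j)$ for every $i\in\{1,\dots,n\}$. Greedy coupling algorithm: set $p_\ell^1=p_\ell$ for $\ell=1,\dots,m$. At step $t=1,2,\dots$, as long as the remaining mass $\sum_k p_1^t(k)$ is positive, for each $\ell$ choose an index $k_\ell$ maximizing $p_\ell^t(k)$ over $k\in\{1,\dots,n\}$, set $\mathcal{G}_S(t)=\min_{\ell}p_\ell^t(k_\ell)$, and let $p_\ell^{t+1}$ be obtained from $p_\ell^t$ by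 subtracting $\mathcal{G}_S(t)$ from its entry at index $k_\ell$ (entries are not re-indexed). The output weights $\mathcal{G}_S(1),\mathcal{G}_S(2),\dots$ form a probability distribution, denoted $\mathcal{G}_S$ (with $\mathcal{G}_S(t)=0$ after termination). *)

theory Defs
  imports Complex_Main
begin

text \<open>
  A distribution is a sequence \<open>nat \<Rightarrow> real\<close> of state weights, indexed from \<open>0\<close> in non-increasing
  order. A distribution on \<open>n\<close> states is padded with zeros, so distributions with different
  numbers of states live in the same type.
\<close>

definition distributions :: "nat \<Rightarrow> (nat \<Rightarrow> real) set" where
  "distributions n =
     {p. (\<forall>k. 0 \<le> p k) \<and> antimono p \<and> (\<forall>k\<ge>n. p k = 0) \<and> (\<Sum>k<n. p k) = 1}"

text \<open>States of weight \<open>0\<close> contribute \<open>0 * log 2 (1 / 0) = 0\<close>.\<close>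

definition entropy :: "(nat \<Rightarrow> real) \<Rightarrow> real" where
  "entropy p = (\<Sum>k. p k * log 2 (1 / p k))"

definition majorized_by :: "(nat \<Rightarrow> real) \<Rightarrow> (nat \<Rightarrow> real) \<Rightarrow> bool"  (infix "\<preceq>" 50) where
  "p \<preceq> q \<longleftrightarrow> (\<forall>i. (\<Sum>j<i. p j) \<le> (\<Sum>j<i. q j))"

text \<open>Here \<open>M\<close> and the competing lower bounds \<open>r\<close> may have any number of states.\<close>

definition is_maj_glb :: "(nat \<Rightarrow> real) set \<Rightarrow> (nat \<Rightarrow> real) \<Rightarrow> bool" where
  "is_maj_glb S M \<longleftrightarrow>
     M \<in> (\<Union>n. distributions n) \<and> (\<forall>p\<in>S. M \<preceq> p) \<and>
     (\<forall>r \<in> (\<Union>n. distributions n). (\<forall>p\<in>S. r \<preceq> p) \<longrightarrow> r \<preceq> M)"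

definition maj_glb :: "(nat \<Rightarrow> real) set \<Rightarrow> nat \<Rightarrow> real" where
  "maj_glb S = (THE M. is_maj_glb S M)"

text \<open>
  \<open>q t l\<close> is what remains of the \<open>l\<close>-th marginal \<open>p l\<close> after \<open>t\<close> steps, \<open>\<kappa> t l\<close> is the index of a
  maximal entry of it (ties are broken arbitrarily), and \<open>G t\<close> is the weight output in that step.
  All marginals have the same remaining mass, so it is read off from the \<open>0\<close>-th one.
\<close>

definition greedy_run ::
  "nat \<Rightarrow> nat \<Rightarrow> (nat \<Rightarrow> nat \<Rightarrow> real) \<Rightarrow> (nat \<Rightarrow> nat \<Rightarrow> nat \<Rightarrow> real) \<Rightarrow> (nat \<Rightarrow> nat \<Rightarrow> nat) \<Rightarrow>
     (nat \<Rightarrow> real) \<Rightarrow> bool"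
where
  "greedy_run m n p q \<kappa> G \<longleftrightarrow>
     (\<forall>l<m. q 0 l = p l) \<and>
     (\<forall>t. if 0 < (\<Sum>k<n. q t 0 k)
          then (\<forall>l<m. \<kappa> t l < n \<and> (\<forall>k<n. q t l k \<le> q t l (\<kappa> t l))) \<and>
               G t = (MIN l\<in>{..<m}. q t l (\<kappa> t l)) \<and>
               (\<forall>l<m. q (Suc t) l = (q t l)(\<kappa> t l := q t l (\<kappa> t l) - G t))
          else G t = 0 \<and> (\<forall>l<m. q (Suc t) l = q t l))"

definition greedy_output :: "nat \<Rightarrow> nat \<Rightarrow> (nat \<Rightarrow> nat \<Rightarrow> real) \<Rightarrow> (nat \<Rightarrow> real) \<Rightarrow> bool" where
  "greedy_output m n p G \<longleftrightarrow> (\<exists>q \<kappa>. greedy_run m n p q \<kappa> G)"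


subsection \<open>The greatest lower bound exists and is given by the minimal partial sums\<close>

lemma sum_ge_distribution:
  assumes "p \<in> distributions n" "n \<le> i"
  shows "(\<Sum>k<i. p k) = 1"
proof -
  have "(\<Sum>k<n. p k) = (\<Sum>k<i. p k)"
    using assms by (intro sum.mono_neutral_left) (auto simp: distributions_def)
  then show ?thesis using assms by (simp add: distributions_def)
qed

lemma maj_antisym:
  assumes "p \<preceq> q" "q \<preceq> p"
  shows "p = q"
proof
  fix k
  have eq: "(\<Sum>j<i. p j) = (\<Sum>j<i. q j)" for i
    using assms by (simp add: majorized_by_def order_antisym)
  show "p k = q k" using eq[of k] eq[of "Suc k"] by simp
qed

lemma is_maj_glb_explicit:
  assumes "finite S" "S \<noteq> {}" "S \<subseteq> distributions n"
  obtains M where "M \<in> distributions n" "is_maj_glb S M"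
    "\<And>i. (\<Sum>j<i. M j) = (MIN p\<in>S. \<Sum>j<i. p j)"
proof -
  define F where "F i = (MIN p\<in>S. \<Sum>j<i. p j)" for i :: nat
  define M where "M i = F (Suc i) - F i" for i
  have F_le: "F i \<le> (\<Sum>j<i. p j)" if "p \<in> S" for p i
    unfolding F_def using assms that by (intro Min_le) auto
  have F_in: "\<exists>p\<in>S. F i = (\<Sum>j<i. p j)" for i
  proof -
    have "F i \<in> (\<lambda>p. \<Sum>j<i. p j) ` S"
      unfolding F_def using assms by (intro Min_in) auto
    then show ?thesis by auto
  qed
  have F0: "F 0 = 0" using F_in[of 0] by auto
  have F1: "F i = 1" if "n \<le> i" for i
    using F_in[of i] assms(3) that by (auto simp: sum_ge_distribution subset_iff)
  have sum_M: "(\<Sum>j<i. M j) = F i" for i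
    unfolding M_def by (simp add: sum_lessThan_telescope F0)
  have nonneg: "0 \<le> M i" for i
  proof -
    obtain p where p: "p \<in> S" "F (Suc i) = (\<Sum>j<Suc i. p j)" using F_in by blast
    have "0 \<le> p i" using p assms(3) by (auto simp: distributions_def)
    then show ?thesis using p F_le[OF p(1), of i] by (simp add: M_def)
  qed
  have "M (Suc i) \<le> M i" for i
  proof -
    obtain p where p: "p \<in> S" "F (Suc i) = (\<Sum>j<Suc i. p j)" using F_in by blast
    have "p (Suc i) \<le> p i"
      using p assms(3) by (auto simp: distributions_def intro: antimonoD)
    then show ?thesis
      using p F_le[OF p(1), of i] F_le[OF p(1), of "Suc (Suc i)"] by (simp add: M_def)
  qed
  then have anti: "antimono M" by (rule decseq_SucI)
  have M: "M \<in> distributions n"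
    unfolding distributions_def using nonneg anti F1 sum_M by (auto simp: M_def)
  have "is_maj_glb S M"
    unfolding is_maj_glb_def
  proof (intro conjI ballI impI)
    show "M \<in> (\<Union>n. distributions n)" using M by blast
    show "M \<preceq> p" if "p \<in> S" for p using F_le[OF that] by (simp add: majorized_by_def sum_M)
    show "r \<preceq> M" if "\<forall>p\<in>S. r \<preceq> p" for r
      unfolding majorized_by_def sum_M
    proof
      fix i
      show "(\<Sum>j<i. r j) \<le> F i"
        using F_in[of i] that by (auto simp: majorized_by_def)
    qed
  qed
  then show ?thesis using that M sum_M by (auto simp: F_def)
qed

lemma is_maj_glb_unique:
  assumes "is_maj_glb S M" "is_maj_glb S M'"
  shows "M = M'"
  using assms by (intro maj_antisym) (auto simp: is_maj_glb_def)

lemma maj_glb: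
  assumes "finite S" "S \<noteq> {}" "S \<subseteq> distributions n"
  shows "is_maj_glb S (maj_glb S)"
    and "maj_glb S \<in> distributions n"
    and "(\<Sum>j<i. maj_glb S j) = (MIN p\<in>S. \<Sum>j<i. p j)"
proof -
  obtain M where M: "M \<in> distributions n" "is_maj_glb S M"
    "\<And>i. (\<Sum>j<i. M j) = (MIN p\<in>S. \<Sum>j<i. p j)"
    using is_maj_glb_explicit[OF assms] by blast
  have "maj_glb S = M"
    unfolding maj_glb_def using M(2) is_maj_glb_unique by blast
  then show "is_maj_glb S (maj_glb S)" "maj_glb S \<in> distributions n"
    "(\<Sum>j<i. maj_glb S j) = (MIN p\<in>S. \<Sum>j<i. p j)" using M by auto
qed


subsection \<open>Greedy runs exist, terminate, and output a probability distribution\<close>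

lemma greedy_output_exists:
  assumes "n \<ge> 1"
  shows "\<exists>G. greedy_output m n p G"
proof -
  define arg :: "(nat \<Rightarrow> real) \<Rightarrow> nat" where
    "arg f = (SOME i. i < n \<and> (\<forall>k<n. f k \<le> f i))" for f
  have arg: "arg f < n \<and> (\<forall>k<n. f k \<le> f (arg f))" for f
  proof -
    have "Max (f ` {..<n}) \<in> f ` {..<n}"
      using assms by (intro Max_in) (auto simp: lessThan_empty_iff)
    then obtain i where "i < n" "f i = Max (f ` {..<n})" by auto
    then have "\<exists>i. i < n \<and> (\<forall>k<n. f k \<le> f i)" by (intro exI[of _ i]) auto
    then show ?thesis unfolding arg_def by (rule someI_ex)
  qed
  define w where
    "w s = (if 0 < (\<Sum>k<n. s (0::nat) k) then (MIN l\<in>{..<m}. s l (arg (s l))) else 0)" for s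
  define q where
    "q = rec_nat p (\<lambda>_ s. if 0 < (\<Sum>k<n. s (0::nat) k)
            then (\<lambda>l. (s l)(arg (s l) := s l (arg (s l)) - w s)) else s)"
  have "greedy_run m n p q (\<lambda>t l. arg (q t l)) (\<lambda>t. w (q t))"
    unfolding greedy_run_def using arg by (auto simp: q_def w_def)
  then show ?thesis unfolding greedy_output_def by blast
qed

lemma greedy_output_distribution:
  assumes "m \<ge> 1" and p: "\<And>l. l < m \<Longrightarrow> p l \<in> distributions n" and "greedy_output m n p G"
  shows "\<forall>t. 0 \<le> G t" and "finite {t. G t \<noteq> 0}" and "G sums 1"
proof -
  obtain q \<kappa> where run: "greedy_run m n p q \<kappa> G"
    using assms(3) by (auto simp: greedy_output_def)
  define act where "act t \<longleftrightarrow> 0 < (\<Sum>k<n. q t 0 k)" for t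
  have init: "q 0 l = p l" if "l < m" for l
    using run that by (simp add: greedy_run_def)
  have act: "\<kappa> t l < n \<and> (\<forall>k<n. q t l k \<le> q t l (\<kappa> t l)) \<and>
      q (Suc t) l = (q t l)(\<kappa> t l := q t l (\<kappa> t l) - G t)"
    and Gact: "G t = (MIN l\<in>{..<m}. q t l (\<kappa> t l))" if "act t" "l < m" for t l
    using run that by (auto simp: greedy_run_def act_def)
  have inact: "G t = 0" "\<And>l. l < m \<Longrightarrow> q (Suc t) l = q t l" if "\<not> act t" for t
    using run that unfolding greedy_run_def act_def by (meson)+
  have G_le: "G t \<le> q t l (\<kappa> t l)" if "act t" "l < m" for t l
    unfolding Gact[OF that] using that by (intro Min_le) auto
  have G_in: "\<exists>l<m. G t = q t l (\<kappa> t l)" if "act t" for t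
  proof -
    have "(MIN l\<in>{..<m}. q t l (\<kappa> t l)) \<in> (\<lambda>l. q t l (\<kappa> t l)) ` {..<m}"
      using assms(1) by (intro Min_in) (auto simp: lessThan_empty_iff)
    then show ?thesis using Gact[OF that, of 0] assms(1) by auto
  qed
  have inv: "(\<forall>l<m. (\<forall>k<n. 0 \<le> q t l k) \<and> (\<Sum>k<n. q t l k) = 1 - (\<Sum>s<t. G s))" for t
  proof (induction t)
    case 0
    then show ?case using p by (auto simp: init distributions_def)
  next
    case (Suc t)
    show ?case
    proof (cases "act t")
      case False
      then show ?thesis using Suc by (simp add: inact)
    next
      case True
      show ?thesis
      proof (intro allI impI)
        fix l assume l: "l < m"
        note a = act[OF True l]
        have "(\<Sum>k<n. q (Suc t) l k) = (\<Sum>k<n. q t l k) - G t"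
          using a by (simp add: sum.remove[of "{..<n}" "\<kappa> t l"])
        then show "(\<forall>k<n. 0 \<le> q (Suc t) l k) \<and>
            (\<Sum>k<n. q (Suc t) l k) = 1 - (\<Sum>s<Suc t. G s)"
          using a Suc l G_le[OF True l] by auto
      qed
    qed
  qed
  have G_pos: "0 < G t" if at: "act t" for t
  proof -
    obtain l where l: "l < m" "G t = q t l (\<kappa> t l)" using G_in[OF at] by blast
    have "0 < (\<Sum>k<n. q t l k)" using inv[of t] l at assms(1) by (simp add: act_def)
    then obtain k where "k < n" "0 < q t l k"
      by (metis lessThan_iff not_le sum_nonpos)
    then show ?thesis using act[OF at l(1)] l(2) by fastforce
  qed
  then show nonneg: "\<forall>t. 0 \<le> G t" using inact(1) by (metis less_eq_real_def)
  define A where "A t = {(l,k). l < m \<and> k < n \<and> 0 < q t l k}" for t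
  have finA: "finite (A t)" for t
    by (rule finite_subset[of _ "{..<m} \<times> {..<n}"]) (auto simp: A_def)
  have step: "card (A (Suc t)) < card (A t)" if at: "act t" for t
  proof (rule psubset_card_mono[OF finA])
    obtain l where l: "l < m" "G t = q t l (\<kappa> t l)" using G_in[OF at] by blast
    have "A (Suc t) \<subseteq> A t"
    proof
      fix x assume "x \<in> A (Suc t)"
      then obtain l k where x: "x = (l, k)" "l < m" "k < n" "0 < q (Suc t) l k"
        by (auto simp: A_def)
      then show "x \<in> A t"
        using act[OF at x(2)] G_pos[OF at] by (auto simp: A_def split: if_splits)
    qed
    moreover have "(l, \<kappa> t l) \<in> A t - A (Suc t)"
      using act[OF at l(1)] G_pos[OF at] l by (auto simp: A_def)
    ultimately show "A (Suc t) \<subset> A t" by blast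
  qed
  have "\<exists>t. \<not> act t"
  proof (rule ccontr)
    assume "\<not> ?thesis"
    then have "card (A t) + t \<le> card (A 0)" for t
    proof (induction t)
      case (Suc t)
      then show ?case using step[of t] by fastforce
    qed simp
    from this[of "Suc (card (A 0))"] show False by simp
  qed
  then obtain T where T: "\<not> act T" by blast
  have stop: "\<not> act t" if "T \<le> t" for t
    using that
  proof (induction rule: dec_induct)
    case (step t)
    then show ?case using inact(2)[of t 0] assms(1) by (simp add: act_def)
  qed (rule T)
  have zero: "G t = 0" if "T \<le> t" for t using stop[OF that] inact(1) by blast
  have sub: "{t. G t \<noteq> 0} \<subseteq> {..<T}"
  proof
    fix t assume "t \<in> {t. G t \<noteq> 0}"
    then show "t \<in> {..<T}" using zero[of t] by (cases "t < T") auto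
  qed
  show "finite {t. G t \<noteq> 0}" using sub by (rule finite_subset) simp
  have "(\<Sum>k<n. q T 0 k) = 0"
    using T inv[of T] assms(1) by (intro antisym sum_nonneg) (auto simp: act_def)
  then have "(\<Sum>s<T. G s) = 1" using inv[of T] assms(1) by auto
  moreover have "G sums (\<Sum>s<T. G s)"
    by (rule sums_finite) (use zero in auto)
  ultimately show "G sums 1" by simp
qed

end

theory Submission
  imports Defs "HOL-Analysis.Analysis"
begin

text \<open>
  For a threshold \<open>z\<close>, consider the first step in which the greedy algorithm outputs a weight at
  most \<open>z\<close>. Some marginal then has only entries at most \<open>z\<close> left, so the remaining mass is at most
  \<open>\<Sum>k. min (p k) z\<close> for that marginal \<open>p\<close>. As \<open>\<lambda>x. min x z\<close> is concave and
  \<open>\<And>S \<preceq> p\<close>, this is at most \<open>\<Sum>k. min (\<And>S k) z\<close>; so the output weights that are at most \<open>z\<close>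
  have total mass at most \<open>\<Sum>k. min (\<And>S k) z\<close>. Integrating this against \<open>dz / z\<close> over the unit
  interval gives the entropy of the output on the left and, since
  \<open>\<integral>\<^sub>0\<^sup>1 min x z / z dz = x + x ln (1 / x)\<close>, the entropy of \<open>\<And>S\<close> plus \<open>1\<close> (in nats) on the right.
\<close>

section \<open>Majorization and truncated sums\<close>

text \<open>Since \<open>min x z = x - max (x - z) 0\<close> and the totals agree, it suffices to
  compare the excesses over \<open>z\<close>. As \<open>r\<close> is sorted, its excess sits on an
  initial segment, where majorization bounds it directly.\<close>

lemma sum_min_le_of_majorized:
  fixes r p :: "nat \<Rightarrow> real"
  assumes "antimono r" "r \<preceq> p" and eq: "(\<Sum>k<n. r k) = (\<Sum>k<n. p k)"
  shows "(\<Sum>k<n. min (p k) z) \<le> (\<Sum>k<n. min (r k) z)"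
proof -
  \<comment> \<open>The length of the initial segment on which \<open>r\<close> exceeds
    \<open>z\<close>. The disjunct \<open>n \<le> k\<close> guarantees that the minimum exists and
    caps it at \<open>n\<close>.\<close>
  define i where "i = (LEAST k. n \<le> k \<or> r k \<le> z)"
  have i: "n \<le> i \<or> r i \<le> z"
    unfolding i_def by (rule LeastI[of _ n]) simp
  have "i \<le> n" unfolding i_def by (rule Least_le) simp
  have above: "z < r k" if "k < i" for k
    using not_less_Least[of k "\<lambda>k. n \<le> k \<or> r k \<le> z"] that by (simp add: i_def)
  have below: "r k \<le> z" if "i \<le> k" "k < n" for k
    using i that antimonoD[OF \<open>antimono r\<close> \<open>i \<le> k\<close>] by auto
  have "(\<Sum>k<n. max (r k - z) 0) = (\<Sum>k<i. max (r k - z) 0)"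
    using \<open>i \<le> n\<close> below by (intro sum.mono_neutral_right) auto
  also have "\<dots> = (\<Sum>k<i. r k - z)"
    using above by (intro sum.cong) (auto intro: less_imp_le)
  also have "\<dots> \<le> (\<Sum>k<i. p k - z)"
    using \<open>r \<preceq> p\<close> by (simp add: majorized_by_def sum_subtractf)
  also have "\<dots> \<le> (\<Sum>k<i. max (p k - z) 0)" by (intro sum_mono) simp
  also have "\<dots> \<le> (\<Sum>k<n. max (p k - z) 0)"
    using \<open>i \<le> n\<close> by (intro sum_mono2) auto
  finally have le: "(\<Sum>k<n. max (r k - z) 0) \<le> (\<Sum>k<n. max (p k - z) 0)" .
  have min_max: "min x z = x - max (x - z) 0" for x :: real by (simp add: min_def max_def)
  show ?thesis using le eq by (simp add: min_max sum_subtractf)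
qed

section \<open>Mass left by the greedy algorithm\<close>

lemma greedy_run_remainder:
  assumes run: "greedy_run m n p q \<kappa> G" and "\<And>t. 0 \<le> G t" and "l < m"
  shows "q t l k \<le> p l k" and "(\<Sum>k<n. q t l k) = (\<Sum>k<n. p l k) - (\<Sum>s<t. G s)"
proof (induction t arbitrary: k)
  case 0
  { case 1 show ?case using assms by (simp add: greedy_run_def) }
  { case 2 show ?case using assms by (simp add: greedy_run_def) }
next
  case (Suc t)
  have step: "\<kappa> t l < n \<and> q (Suc t) l = (q t l)(\<kappa> t l := q t l (\<kappa> t l) - G t)"
    if "0 < (\<Sum>k<n. q t 0 k)"
    using run \<open>l < m\<close> that by (auto simp: greedy_run_def)
  have idle: "G t = 0 \<and> q (Suc t) l = q t l" if "\<not> 0 < (\<Sum>k<n. q t 0 k)"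
    using run \<open>l < m\<close> that by (auto simp: greedy_run_def)
  { case 1
    have "q (Suc t) l k \<le> q t l k"
      using step idle \<open>0 \<le> G t\<close> by (cases "0 < (\<Sum>k<n. q t 0 k)") auto
    then show ?case using Suc(1)[of k] by linarith }
  { case 2
    have "(\<Sum>k<n. q (Suc t) l k) = (\<Sum>k<n. q t l k) - G t"
    proof (cases "0 < (\<Sum>k<n. q t 0 k)")
      case True
      then show ?thesis using step by (simp add: sum.remove[of "{..<n}" "\<kappa> t l"])
    qed (use idle in simp)
    then show ?case using Suc(2) by simp }
qed

text \<open>The marginal attaining the minimum in step \<open>t\<close> has largest remaining entry
  \<open>G t\<close>. So each of its remaining entries is at most \<open>z\<close>, and also at most
  the original entry; their sum is the remaining mass, which is the same for all marginals.\<close>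

lemma greedy_run_tail:
  assumes "m \<ge> 1" and p: "\<And>l. l < m \<Longrightarrow> p l \<in> distributions n"
    and run: "greedy_run m n p q \<kappa> G" and "\<And>t. 0 \<le> G t" and "G t \<le> z" and "0 \<le> z"
  shows "\<exists>l<m. 1 - (\<Sum>s<t. G s) \<le> (\<Sum>k<n. min (p l k) z)"
proof -
  have mass: "(\<Sum>k<n. q t l k) = 1 - (\<Sum>s<t. G s)" if "l < m" for l
    using greedy_run_remainder(2)[OF run assms(4) that] p[OF that] by (simp add: distributions_def)
  show ?thesis
  proof (cases "0 < (\<Sum>k<n. q t 0 k)")
    case True
    then have Gt: "G t = (MIN l\<in>{..<m}. q t l (\<kappa> t l))"
      and max: "\<forall>l<m. \<forall>k<n. q t l k \<le> q t l (\<kappa> t l)"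
      using run by (auto simp: greedy_run_def)
    have "(MIN l\<in>{..<m}. q t l (\<kappa> t l)) \<in> (\<lambda>l. q t l (\<kappa> t l)) ` {..<m}"
      using \<open>m \<ge> 1\<close> by (intro Min_in) (auto simp: lessThan_empty_iff)
    then obtain l where l: "l < m" "G t = q t l (\<kappa> t l)" using Gt by auto
    have "(\<Sum>k<n. q t l k) \<le> (\<Sum>k<n. min (p l k) z)"
      using greedy_run_remainder(1)[OF run assms(4) l(1)] max l \<open>G t \<le> z\<close>
      by (intro sum_mono) fastforce
    then show ?thesis using mass l(1) by auto
  next
    \<comment> \<open>The algorithm has stopped, so the remaining mass is at most 0 and marginal
      \<open>0\<close> serves as witness.\<close>
    case False
    have "0 \<le> (\<Sum>k<n. min (p 0 k) z)"
      using p[of 0] \<open>m \<ge> 1\<close> \<open>0 \<le> z\<close> by (intro sum_nonneg) (auto simp: distributions_def)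
    then show ?thesis using False mass[of 0] \<open>m \<ge> 1\<close> by (intro exI[of _ 0]) auto
  qed
qed

lemma greedy_output_small_mass:
  assumes "m \<ge> 1" and p: "\<And>l. l < m \<Longrightarrow> p l \<in> distributions n"
    and G: "greedy_output m n p G" and "0 \<le> z"
  shows "(\<Sum>t<T. if G t \<le> z then G t else 0) \<le> (\<Sum>k<n. min (maj_glb (p ` {..<m}) k) z)"
proof -
  define M where "M = maj_glb (p ` {..<m})"
  have S: "finite (p ` {..<m})" "p ` {..<m} \<noteq> {}" "p ` {..<m} \<subseteq> distributions n"
    using \<open>m \<ge> 1\<close> p by (auto simp: lessThan_empty_iff)
  have M: "M \<in> distributions n" "is_maj_glb (p ` {..<m}) M"
    unfolding M_def using maj_glb(1,2)[OF S] by auto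
  have nonneg: "\<And>t. 0 \<le> G t" and G1: "G sums 1"
    using greedy_output_distribution[OF \<open>m \<ge> 1\<close> p G] by auto
  show ?thesis
  proof (cases "\<exists>t<T. G t \<le> z")
    case False
    then have "(\<Sum>t<T. if G t \<le> z then G t else 0) = 0" by (intro sum.neutral) auto
    moreover have "0 \<le> (\<Sum>k<n. min (M k) z)"
      using M(1) \<open>0 \<le> z\<close> by (intro sum_nonneg) (auto simp: distributions_def)
    ultimately show ?thesis by (simp add: M_def)
  next
    case True
    define t where "t = (LEAST t. G t \<le> z)"
    have t: "G t \<le> z" "\<And>s. G s \<le> z \<Longrightarrow> t \<le> s"
      unfolding t_def using True by (auto intro: LeastI Least_le)
    have "t < T" using True t(2) by fastforce
    obtain q \<kappa> where run: "greedy_run m n p q \<kappa> G" using G by (auto simp: greedy_output_def)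
    obtain l where l: "l < m" "1 - (\<Sum>s<t. G s) \<le> (\<Sum>k<n. min (p l k) z)"
      using greedy_run_tail[OF \<open>m \<ge> 1\<close> p run nonneg t(1) \<open>0 \<le> z\<close>] by auto
    \<comment> \<open>No weight at most \<open>z\<close> is output before step \<open>t\<close>, so
      the small weights are bounded by everything output from \<open>t\<close> on, whether small or
      not.\<close>
    have "(\<Sum>s<T. if G s \<le> z then G s else 0) \<le> (\<Sum>s<T. if t \<le> s then G s else 0)"
      using t(2) nonneg by (intro sum_mono) auto
    also have "\<dots> = (\<Sum>s<T. G s - (if s < t then G s else 0))"
      by (intro sum.cong) auto
    also have "\<dots> = (\<Sum>s<T. G s) - (\<Sum>s<T. if s < t then G s else 0)"
      by (rule sum_subtractf)
    also have "(\<Sum>s<T. if s < t then G s else 0) = (\<Sum>s<t. G s)"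
      using \<open>t < T\<close> by (intro sum.mono_neutral_cong_right) auto
    also have "(\<Sum>s<T. G s) - (\<Sum>s<t. G s) \<le> 1 - (\<Sum>s<t. G s)"
      using sum_le_suminf[of G "{..<T}"] G1 nonneg by (simp add: sums_iff)
    also have "1 - (\<Sum>s<t. G s) \<le> (\<Sum>k<n. min (p l k) z)" by (rule l(2))
    also have "\<dots> \<le> (\<Sum>k<n. min (M k) z)"
      using M p[OF l(1)] l(1)
      by (intro sum_min_le_of_majorized) (auto simp: distributions_def is_maj_glb_def)
    finally show ?thesis by (simp add: M_def)
  qed
qed

section \<open>Integrals against dz / z\<close>

lemma has_integral_divide_ident:
  fixes a b c :: real
  assumes "0 < a" "a \<le> b"
  shows "((\<lambda>z. c / z) has_integral c * ln b - c * ln a) {a..b}"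
proof (rule fundamental_theorem_of_calculus[OF assms(2)])
  fix z assume "z \<in> {a..b}"
  then have "((\<lambda>z. c * ln z) has_real_derivative c / z) (at z)"
    using assms(1) by (auto intro!: derivative_eq_intros)
  then show "((\<lambda>z. c * ln z) has_vector_derivative c / z) (at z within {a..b})"
    by (simp add: has_real_derivative_iff_has_vector_derivative has_vector_derivative_at_within)
qed

text \<open>The integrand is \<open>x / z\<close> on \<open>{x..1}\<close> and vanishes below
  \<open>x\<close>. The cutoff \<open>e\<close> avoids the singularity at 0, and a nonzero
  \<open>x\<close> is at least \<open>e\<close>, so the value is exact.\<close>

lemma has_integral_step_divide_ident:
  fixes x e :: real
  assumes "0 < e" "x = 0 \<or> e \<le> x" "x \<le> 1"
  shows "((\<lambda>z. (if x \<le> z then x else 0) / z) has_integral x * ln (1 / x)) {e..1}"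
proof (cases "x = 0")
  case False
  then have x: "0 < x" "e \<le> x" using assms by auto
  have "((\<lambda>z. x / z) has_integral x * ln (1 / x)) {x..1}"
    using has_integral_divide_ident[OF x(1) assms(3), of x] x by (simp add: ln_div)
  then have "((\<lambda>z. if z \<in> {x..1} then x / z else 0) has_integral x * ln (1 / x)) {e..1}"
    using x by (subst has_integral_restrict) auto
  then show ?thesis by (rule has_integral_eq[rotated]) auto
next
  case True
  then have "(\<lambda>z. (if x \<le> z then x else 0) / z) = (\<lambda>z. 0)" by auto
  then show ?thesis using True by simp
qed

text \<open>Without the cutoff the integral over the unit interval would equal the bound. For
  \<open>x > e\<close> the cutoff costs \<open>e\<close>; for \<open>x \<le> e\<close> the integral
  is \<open>- (x * ln e)\<close>, at most \<open>x * ln (1 / x)\<close>.\<close>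

lemma has_integral_min_divide_ident_le:
  fixes x e :: real
  assumes "0 < e" "e \<le> 1" "0 \<le> x" "x \<le> 1"
  obtains I where "((\<lambda>z. min x z / z) has_integral I) {e..1}" "I \<le> x + x * ln (1 / x)"
proof (cases "x \<le> e")
  case True
  have "((\<lambda>z. x / z) has_integral - (x * ln e)) {e..1}"
    using has_integral_divide_ident[OF assms(1,2), of x] by simp
  then have "((\<lambda>z. min x z / z) has_integral - (x * ln e)) {e..1}"
    by (rule has_integral_eq[rotated]) (use True in auto)
  moreover have "- (x * ln e) \<le> x + x * ln (1 / x)"
  proof (cases "x = 0")
    case False
    then have "x * ln x \<le> x * ln e" using assms True by (intro mult_left_mono) auto
    moreover have "x * ln (1 / x) = - (x * ln x)" using False assms by (simp add: ln_div)
    ultimately show ?thesis using assms by linarith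
  qed simp
  ultimately show ?thesis by (rule that)
next
  case False
  then have x: "0 < x" "e \<le> x" using assms by auto
  have "((\<lambda>z. 1 :: real) has_integral x - e) {e..x}"
    using has_integral_const_real[of "1 :: real" e x] x by simp
  then have "((\<lambda>z. min x z / z) has_integral x - e) {e..x}"
    by (rule has_integral_eq[rotated]) (use assms in auto)
  moreover have "((\<lambda>z. x / z) has_integral x * ln (1 / x)) {x..1}"
    using has_integral_divide_ident[OF x(1) assms(4), of x] x by (simp add: ln_div)
  then have "((\<lambda>z. min x z / z) has_integral x * ln (1 / x)) {x..1}"
    by (rule has_integral_eq[rotated]) auto
  ultimately have "((\<lambda>z. min x z / z) has_integral (x - e) + x * ln (1 / x)) {e..1}"
    using x(2) assms(4) by (intro has_integral_combine[of e x 1])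
  then show ?thesis using assms(1) by (intro that) auto
qed

lemma sum_entropy_le:
  fixes g r :: "nat \<Rightarrow> real"
  assumes g: "\<And>t. t < T \<Longrightarrow> 0 \<le> g t" "\<And>t. t < T \<Longrightarrow> g t \<le> 1"
    and r: "\<And>k. k < n \<Longrightarrow> 0 \<le> r k" "\<And>k. k < n \<Longrightarrow> r k \<le> 1"
    and small: "\<And>z. 0 < z \<Longrightarrow> (\<Sum>t<T. if g t \<le> z then g t else 0) \<le> (\<Sum>k<n. min (r k) z)"
  shows "(\<Sum>t<T. g t * ln (1 / g t)) \<le> (\<Sum>k<n. r k + r k * ln (1 / r k))"
proof -
  \<comment> \<open>A cutoff below all nonzero weights of \<open>g\<close> keeps the integrals on
    the left exact, while those on the right only need upper bounds. Inserting 1 makes the set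
    nonempty and gives \<open>e \<le> 1\<close>.\<close>
  define e where "e = Min (insert 1 (g ` {t. t < T \<and> g t \<noteq> 0}))"
  have "0 < e" using g(1) unfolding e_def by (subst Min_gr_iff) (auto simp: order_less_le)
  moreover have "e \<le> 1" unfolding e_def by (intro Min_le) auto
  moreover have "g t = 0 \<or> e \<le> g t" if "t < T" for t
    using that unfolding e_def by (cases "g t = 0") (auto intro!: Min_le)
  ultimately have e: "0 < e" "e \<le> 1" "\<And>t. t < T \<Longrightarrow> g t = 0 \<or> e \<le> g t" by auto
  have "\<exists>I. ((\<lambda>z. min (r k) z / z) has_integral I) {e..1} \<and> I \<le> r k + r k * ln (1 / r k)"
    if "k < n" for k
    by (rule has_integral_min_divide_ident_le[OF e(1,2) r(1)[OF that] r(2)[OF that]]) blast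
  then obtain I where I: "\<And>k. k < n \<Longrightarrow> ((\<lambda>z. min (r k) z / z) has_integral I k) {e..1}"
    "\<And>k. k < n \<Longrightarrow> I k \<le> r k + r k * ln (1 / r k)"
    by metis
  have "(\<Sum>t<T. g t * ln (1 / g t)) \<le> (\<Sum>k<n. I k)"
  proof (rule has_integral_le)
    show "((\<lambda>z. \<Sum>t<T. (if g t \<le> z then g t else 0) / z) has_integral
        (\<Sum>t<T. g t * ln (1 / g t))) {e..1}"
      using e g by (intro has_integral_sum has_integral_step_divide_ident) auto
    show "((\<lambda>z. \<Sum>k<n. min (r k) z / z) has_integral (\<Sum>k<n. I k)) {e..1}"
      using I(1) by (intro has_integral_sum) auto
    fix z assume "z \<in> {e..1}"
    then have "0 < z" using e(1) by simp
    then show "(\<Sum>t<T. (if g t \<le> z then g t else 0) / z) \<le> (\<Sum>k<n. min (r k) z / z)"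
      using small[of z] by (simp add: divide_right_mono flip: sum_divide_distrib)
  qed
  also have "\<dots> \<le> (\<Sum>k<n. r k + r k * ln (1 / r k))" using I(2) by (intro sum_mono) auto
  finally show ?thesis .
qed

section \<open>From finite sums with \<open>ln\<close> to entropy in bits\<close>

lemma entropy_eq_sum:
  assumes "\<And>t. N \<le> t \<Longrightarrow> p t = 0"
  shows "entropy p = (\<Sum>t<N. p t * ln (1 / p t)) / ln 2"
proof -
  have "entropy p = (\<Sum>t<N. p t * log 2 (1 / p t))"
    unfolding entropy_def using assms by (intro suminf_finite) auto
  then show ?thesis by (simp add: log_def sum_divide_distrib)
qed

theorem theorem3:
  fixes m n :: nat and p :: "nat \<Rightarrow> nat \<Rightarrow> real" and G :: "nat \<Rightarrow> real"
  assumes "m \<ge> 1" and "n \<ge> 1"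
    and "\<And>l. l < m \<Longrightarrow> p l \<in> distributions n"
    and "greedy_output m n p G"
  shows "entropy G \<le> entropy (maj_glb (p ` {..<m})) + log 2 (exp 1)"
proof -
  define M where "M = maj_glb (p ` {..<m})"
  have M: "M \<in> distributions n"
    unfolding M_def using assms(1,3) by (intro maj_glb(2)) (auto simp: lessThan_empty_iff)
  then have M_sum: "(\<Sum>k<n. M k) = 1" and M_nonneg: "0 \<le> M k" for k
    by (auto simp: distributions_def)
  have G: "0 \<le> G t" "finite {t. G t \<noteq> 0}" "G sums 1" for t
    using greedy_output_distribution[OF assms(1,3,4)] by auto
  \<comment> \<open>A bound on the support of \<open>G\<close>, so that its entropy becomes a finite
    sum.\<close>
  obtain T where T: "\<And>t. T \<le> t \<Longrightarrow> G t = 0"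
    using G(2) unfolding finite_nat_iff_bounded by (auto simp: subset_iff) (metis not_le)
  have "(\<Sum>t<T. G t * ln (1 / G t)) \<le> (\<Sum>k<n. M k + M k * ln (1 / M k))"
  proof (rule sum_entropy_le)
    show "G t \<le> 1" for t
      using sum_le_suminf[of G "{t}"] G by (simp add: sums_iff)
    show "M k \<le> 1" if "k < n" for k
      using member_le_sum[of k "{..<n}" M] that M_nonneg M_sum by simp
    show "(\<Sum>t<T. if G t \<le> z then G t else 0) \<le> (\<Sum>k<n. min (M k) z)" if "0 < z" for z
      unfolding M_def using greedy_output_small_mass[OF assms(1,3,4)] that by simp
  qed (use G M_nonneg in auto)
  also have "\<dots> = 1 + (\<Sum>k<n. M k * ln (1 / M k))" by (simp add: sum.distrib M_sum)
  finally have "entropy G \<le> (1 + (\<Sum>k<n. M k * ln (1 / M k))) / ln 2"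
    by (simp add: entropy_eq_sum[of T G] T divide_right_mono)
  \<comment> \<open>Division by \<open>ln 2\<close> turns the constant 1, the total mass of
    \<open>M\<close>, into \<open>log 2 (exp 1)\<close>.\<close>
  also have "\<dots> = entropy M + log 2 (exp 1)"
    using M by (subst entropy_eq_sum[of n M])
      (auto simp: distributions_def log_def add_divide_distrib)
  finally show ?thesis by (simp add: M_def)
qed

end
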